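(* Let $\Phi=\{\varphi_i\}_{i\in I}$ be a frame for $\mathscr{H}$ with (optimal) lower and upper frame bounds $A$ and $B$ and frame operator $S$. If for some $x \in \mathscr{H}$ and $\sigma \subset I$ we have the equality $\lVert S_\sigma x\rVert = \sqrt{\frac{B}{A}}\, \lVert Sx\rVert$, then (i) $\Phi$ is tight, that is, $A = B$, and (ii) every frame vector removed is orthogonal to $x$, that is, $\langle x, \varphi_i\rangle = 0$ for all $i \in \sigma^c = I\setminus\sigma$.
   Context: $\mathscr{H}$ is a separable, finite or infinite dimensional, real or complex Hilbert space. The index set $I$ is either $\{1,\dots,N\}$ or $\mathbb{N}$. A family $\{\varphi_i\}_{i\in I}$ in $\mathscr{H}$ is a frame for $\mathscr{H}$ if there are constants $0<A\le B<\infty$ with $A\|x\|^2\le \sum_{i\in I}|\langle x,\varphi_i\rangle|^2\le B\|x\|^2$ for all $x\in\mathscr{H}$. Stated frame bounds are always assumed optimal: $A$ is the largest and $B$ the smallest possible value. The frame is tight if $A=B$. The frame operator is $Sx=\sum_{i\in I}\langle x,\varphi_i\rangle\varphi_i$, and for $\sigma\subset I$, $S_\sigma x=\sum_{i\in\sigma}\langle x,\varphi_i\rangle\varphi_i$.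
   Formalization: Conclusion (i), that the frame is tight with A = B, is stated only for nonzero x, since for x = 0 the assumed equality reads 0 = 0 and holds for every frame, including non-tight ones; conclusion (ii) is stated for all x. *)

theory Defs
  imports "HOL-Analysis.Analysis"
begin

text \<open>Up to isomorphism the only members of the following class are the real and the complex
  numbers: the element \<open>i\<close> in the last axiom is either \<open>0\<close> or a square root of \<open>-1\<close>.\<close>

class real_or_complex = real_normed_field +
  fixes conjugate :: "'a \<Rightarrow> 'a"
  assumes conjugate_add: "conjugate (z + w) = conjugate z + conjugate w"
    and conjugate_mult: "conjugate (z * w) = conjugate z * conjugate w"
    and conjugate_conjugate: "conjugate (conjugate z) = z"
    and mult_conjugate: "z * conjugate z = (norm z)\<^sup>2 *\<^sub>R 1"
    and real_or_complex_decomp: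
      "\<exists>i. (i = 0 \<or> i * i = - 1) \<and> (\<forall>z. \<exists>a b. z = a *\<^sub>R 1 + b *\<^sub>R i)"

instantiation real :: real_or_complex
begin
definition conjugate_real :: "real \<Rightarrow> real" where "conjugate_real z = z"
instance
proof
  show "\<exists>i::real. (i = 0 \<or> i * i = - 1) \<and> (\<forall>z. \<exists>a b. z = a *\<^sub>R 1 + b *\<^sub>R i)"
    by (rule exI[of _ 0]) auto
qed (auto simp: conjugate_real_def power2_eq_square)
end

instantiation complex :: real_or_complex
begin
definition conjugate_complex :: "complex \<Rightarrow> complex" where "conjugate_complex z = cnj z"
instance
proof
  have "z = Re z *\<^sub>R 1 + Im z *\<^sub>R \<i>" for z
    by (simp add: complex_eq_iff)
  then show "\<exists>i::complex. (i = 0 \<or> i * i = - 1) \<and> (\<forall>z. \<exists>a b. z = a *\<^sub>R 1 + b *\<^sub>R i)"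
    by (intro exI[of _ \<i>]) (auto intro: exI)
qed (auto simp: conjugate_complex_def complex_norm_square scaleR_conv_of_real simp del: of_real_power)
end

text \<open>The norm, the topology and completeness are those of the type class \<^class>\<open>banach\<close>;
  \<open>ip_self\<close> says that the norm is the one induced by the inner product.\<close>

locale hilbert_space = vector_space smul
  for smul :: "'k::real_or_complex \<Rightarrow> 'a::banach \<Rightarrow> 'a" +
  fixes ip :: "'a \<Rightarrow> 'a \<Rightarrow> 'k"
  assumes scale_of_real: "smul (of_real r) x = r *\<^sub>R x"
    and ip_add_left: "ip (x + y) z = ip x z + ip y z"
    and ip_scale_left: "ip (smul c x) y = c * ip x y"
    and ip_commute: "ip y x = conjugate (ip x y)"
    and ip_self: "ip x x = of_real ((norm x)\<^sup>2)"

text \<open>Over the reals this is the library's notion of a Hilbert space.\<close>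

lemma hilbert_space_real:
  "hilbert_space (scaleR :: real \<Rightarrow> 'a::{real_inner,banach} \<Rightarrow> 'a) inner"
  by unfold_locales
    (auto simp: inner_add_left intro: inner_commute simp: conjugate_real_def power2_norm_eq_inner
      scaleR_right_distrib scaleR_left_distrib)

lemma hilbert_space_complex:
  "hilbert_space ((*) :: complex \<Rightarrow> complex \<Rightarrow> complex) (\<lambda>x y. x * cnj y)"
  by unfold_locales
    (auto simp: algebra_simps conjugate_complex_def complex_norm_square scaleR_conv_of_real simp del: of_real_power)

definition separable :: "'a::topological_space itself \<Rightarrow> bool" where
  "separable _ \<longleftrightarrow> (\<exists>D :: 'a set. countable D \<and> closure D = UNIV)"

definition frame_index_set :: "nat set \<Rightarrow> bool" where
  "frame_index_set I \<longleftrightarrow> (\<exists>N\<ge>1. I = {1..N}) \<or> I = UNIV"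

text \<open>An unordered sum that does not converge has the value \<open>0\<close> in the library, so summability
  (that is, finiteness of the sum of squares) has to be required explicitly.\<close>

definition frame_bounds ::
  "('a::real_normed_vector \<Rightarrow> 'a \<Rightarrow> 'k::real_or_complex) \<Rightarrow> nat set \<Rightarrow> (nat \<Rightarrow> 'a) \<Rightarrow> real \<Rightarrow> real \<Rightarrow> bool"
  where
  "frame_bounds ip I \<phi> A B \<longleftrightarrow> 0 < A \<and> A \<le> B \<and>
    (\<forall>x. (\<lambda>i. (norm (ip x (\<phi> i)))\<^sup>2) summable_on I \<and>
      A * (norm x)\<^sup>2 \<le> (\<Sum>\<^sub>\<infinity>i\<in>I. (norm (ip x (\<phi> i)))\<^sup>2) \<and>
      (\<Sum>\<^sub>\<infinity>i\<in>I. (norm (ip x (\<phi> i)))\<^sup>2) \<le> B * (norm x)\<^sup>2)"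

definition frame ::
  "('a::real_normed_vector \<Rightarrow> 'a \<Rightarrow> 'k::real_or_complex) \<Rightarrow> nat set \<Rightarrow> (nat \<Rightarrow> 'a) \<Rightarrow> bool" where
  "frame ip I \<phi> \<longleftrightarrow> (\<exists>A B. frame_bounds ip I \<phi> A B)"

definition optimal_frame_bounds ::
  "('a::real_normed_vector \<Rightarrow> 'a \<Rightarrow> 'k::real_or_complex) \<Rightarrow> nat set \<Rightarrow> (nat \<Rightarrow> 'a) \<Rightarrow> real \<Rightarrow> real \<Rightarrow> bool"
  where
  "optimal_frame_bounds ip I \<phi> A B \<longleftrightarrow> frame_bounds ip I \<phi> A B \<and>
    (\<forall>A' B'. frame_bounds ip I \<phi> A' B' \<longrightarrow> A' \<le> A \<and> B \<le> B')"

definition tight_frame ::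
  "('a::real_normed_vector \<Rightarrow> 'a \<Rightarrow> 'k::real_or_complex) \<Rightarrow> nat set \<Rightarrow> (nat \<Rightarrow> 'a) \<Rightarrow> bool" where
  "tight_frame ip I \<phi> \<longleftrightarrow> (\<exists>A B. optimal_frame_bounds ip I \<phi> A B \<and> A = B)"

text \<open>The operator \<open>S\<^sub>\<sigma>\<close>; the frame operator is the case where \<open>\<sigma>\<close> is the whole index set.
  The series of a frame converges unconditionally, so the unordered sum is its value.\<close>

definition partial_frame_operator ::
  "('k::real_or_complex \<Rightarrow> 'a::real_normed_vector \<Rightarrow> 'a) \<Rightarrow> ('a \<Rightarrow> 'a \<Rightarrow> 'k) \<Rightarrow> (nat \<Rightarrow> 'a) \<Rightarrow> nat set \<Rightarrow> 'a \<Rightarrow> 'a"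
  where
  "partial_frame_operator smul ip \<phi> \<sigma> x = (\<Sum>\<^sub>\<infinity>i\<in>\<sigma>. smul (ip x (\<phi> i)) (\<phi> i))"

end

theory Submission
  imports Defs
begin

text \<open>
  Write \<open>q\<^sub>\<sigma> x = (\<Sum>\<^sub>\<infinity>i\<in>\<sigma>. (norm (ip x (\<phi> i)))\<^sup>2)\<close>, so that \<open>q\<^sub>\<sigma> x = ip (S\<^sub>\<sigma> x) x\<close>. Two inequalities
  carry the proof. The adjoint of the analysis map \<open>y \<mapsto> (ip y (\<phi> i))\<^sub>i\<close> has the same norm as that
  map, at most \<open>sqrt B\<close>, whence \<open>(norm (S\<^sub>\<sigma> x))\<^sup>2 \<le> B * q\<^sub>\<sigma> x\<close>
  (\<open>norm_partial_frame_operator_le\<close>). On the other side,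
  the Cauchy--Schwarz inequality for \<open>ip (S x) x\<close> and the lower frame bound give
  \<open>A * q\<^sub>I x \<le> (norm (S x))\<^sup>2\<close> (\<open>norm_frame_operator_ge\<close>). Under the hypothesis
  \<open>norm (S\<^sub>\<sigma> x) = sqrt (B / A) * norm (S x)\<close> they combine to
  \<open>B * q\<^sub>I x \<le> B / A * (norm (S x))\<^sup>2 = (norm (S\<^sub>\<sigma> x))\<^sup>2 \<le> B * q\<^sub>\<sigma> x \<le> B * q\<^sub>I x\<close>.
  Hence \<open>q\<^sub>\<sigma> x = q\<^sub>I x\<close>: the terms with index outside \<open>\<sigma>\<close> vanish, which is the orthogonality claim.
  But then \<open>S\<^sub>\<sigma> x = S x\<close>, and the hypothesis reads \<open>norm (S x) = sqrt (B / A) * norm (S x)\<close>.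
  For \<open>x \<noteq> 0\<close> the lower bound makes \<open>S x\<close> nonzero, so that \<open>B / A = 1\<close>.

  The identity \<open>q\<^sub>\<sigma> x = ip (S\<^sub>\<sigma> x) x\<close> presupposes that the series of \<open>S\<^sub>\<sigma> x\<close> converges
  unconditionally. The adjoint bound, applied to finite index sets, gives this by completeness
  (\<open>summable_on_if_norm_sum_square_le\<close>).
\<close>

section \<open>Series with square-dominated partial sums\<close>

text \<open>Up to the factor \<open>sqrt C\<close>, the norm of any finite block of the series of \<open>f\<close> is at most the
  square root of the same block of a convergent series, so the partial sums form a Cauchy net. This gives unconditional convergence
  for series which, like those of a frame, need not converge absolutely.\<close>

lemma summable_on_if_norm_sum_square_le:
  fixes f :: "'i \<Rightarrow> 'a::banach" and g :: "'i \<Rightarrow> real"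
  assumes g: "g summable_on A" and g_nonneg: "\<And>i. i \<in> A \<Longrightarrow> 0 \<le> g i" and C: "0 \<le> C"
    and le: "\<And>F. finite F \<Longrightarrow> F \<subseteq> A \<Longrightarrow> (norm (sum f F))\<^sup>2 \<le> C * sum g F"
  shows "f summable_on A"
proof -
  have "\<exists>P. eventually P (finite_subsets_at_top A) \<and>
          (\<forall>F F'. P F \<and> P F' \<longrightarrow> dist (sum f F) (sum f F') < e)" if e: "0 < e" for e
  proof -
    \<comment> \<open>chosen so that \<open>C * \<delta> < (e / 2)\<^sup>2\<close>\<close>
    define \<delta> where "\<delta> = (e / 2)\<^sup>2 / (C + 1)"
    have \<delta>: "0 < \<delta>" using e C by (simp add: \<delta>_def)
    have "C * \<delta> < (C + 1) * \<delta>" using \<delta> by (simp add: algebra_simps)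
    also have "\<dots> = (e / 2)\<^sup>2" using C by (simp add: \<delta>_def)
    finally have C\<delta>: "C * \<delta> < (e / 2)\<^sup>2" .
    obtain F0 where F0: "finite F0" "F0 \<subseteq> A" and near: "dist (sum g F0) (infsum g A) \<le> \<delta>"
      using infsum_finite_approximation[OF g \<delta>] by blast
    define P where "P F \<longleftrightarrow> finite F \<and> F0 \<subseteq> F \<and> F \<subseteq> A" for F
    have close: "dist (sum f F) (sum f F0) < e / 2" if "P F" for F
    proof -
      have F: "finite F" "F0 \<subseteq> F" "F \<subseteq> A" using that by (auto simp: P_def)
      have "sum g F \<le> infsum g A"
        using F by (intro finite_sum_le_infsum g) (auto intro: g_nonneg)
      then have tail: "sum g (F - F0) \<le> \<delta>"
        using near F by (simp add: sum_diff dist_real_def)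
      have "(norm (sum f (F - F0)))\<^sup>2 \<le> C * sum g (F - F0)"
        using F by (intro le) auto
      also have "\<dots> \<le> C * \<delta>" using tail C by (rule mult_left_mono)
      also have "\<dots> < (e / 2)\<^sup>2" by (rule C\<delta>)
      finally have "norm (sum f (F - F0)) < e / 2"
        using e by (intro power2_less_imp_less[of _ "e / 2"]) auto
      then show ?thesis using F F0 by (simp add: dist_norm sum_diff)
    qed
    have "eventually P (finite_subsets_at_top A)"
      unfolding eventually_finite_subsets_at_top P_def using F0 by auto
    moreover have "dist (sum f F) (sum f F') < e" if "P F" "P F'" for F F'
      using close[OF that(1)] close[OF that(2)] by (rule dist_triangle_half_l)
    ultimately show ?thesis by blast
  qed
  then have "cauchy_filter (filtermap (sum f) (finite_subsets_at_top A))"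
    by (simp add: cauchy_filter_metric_filtermap)
  then show ?thesis
    by (auto dest!: cauchy_filter_convergent
        simp: convergent_filter_iff summable_on_def has_sum_def filterlim_def)
qed

lemma norm_has_sum_square_le:
  fixes f :: "'i \<Rightarrow> 'a::real_normed_vector" and g :: "'i \<Rightarrow> real"
  assumes f: "(f has_sum s) A"
    and g: "g summable_on A" and g_nonneg: "\<And>i. i \<in> A \<Longrightarrow> 0 \<le> g i" and C: "0 \<le> C"
    and le: "\<And>F. finite F \<Longrightarrow> F \<subseteq> A \<Longrightarrow> (norm (sum f F))\<^sup>2 \<le> C * sum g F"
  shows "(norm s)\<^sup>2 \<le> C * infsum g A"
proof (rule tendsto_upperbound)
  show "((\<lambda>F. (norm (sum f F))\<^sup>2) \<longlongrightarrow> (norm s)\<^sup>2) (finite_subsets_at_top A)"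
    using f unfolding has_sum_def by (intro tendsto_intros)
  have "(norm (sum f F))\<^sup>2 \<le> C * infsum g A" if F: "finite F" "F \<subseteq> A" for F
  proof -
    have "sum g F \<le> infsum g A"
      using F by (intro finite_sum_le_infsum g) (auto intro: g_nonneg)
    then show ?thesis using le[OF F] C by (meson mult_left_mono order_trans)
  qed
  then show "eventually (\<lambda>F. (norm (sum f F))\<^sup>2 \<le> C * infsum g A) (finite_subsets_at_top A)"
    by (intro eventually_finite_subsets_at_top_weakI)
qed (rule finite_subsets_at_top_neq_bot)

section \<open>The Cauchy--Schwarz inequality\<close>

lemma conjugate_zero: "conjugate 0 = (0 :: 'k::real_or_complex)"
  using conjugate_add[of "0::'k" 0] by simp

lemma norm_conjugate: "norm (conjugate z) = norm (z :: 'k::real_or_complex)"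
proof (cases "z = 0")
  case False
  have "norm z * norm (conjugate z) = norm z * norm z"
    using arg_cong[OF mult_conjugate[of z], of norm]
    by (simp add: norm_mult power2_eq_square)
  then show ?thesis using False by simp
qed (simp add: conjugate_zero)

context hilbert_space
begin

lemma ip_diff_left: "ip (x - y) z = ip x z - ip y z"
  using ip_add_left[of "x - y" y z] by simp

lemma norm_ip_commute: "norm (ip x y) = norm (ip y x)"
  by (metis ip_commute norm_conjugate)

lemma ip_mult_ip_commute: "ip x y * ip y x = of_real ((norm (ip x y))\<^sup>2)"
  by (metis ip_commute mult_conjugate of_real_def)

lemma ip_zero_right: "ip x 0 = 0"
  using ip_diff_left[of 0 0 x] ip_commute[of x 0] by (simp add: conjugate_zero)

text \<open>The component \<open>w\<close> of \<open>x\<close> orthogonal to \<open>y\<close> satisfies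
  \<open>(norm w)\<^sup>2 = (norm x)\<^sup>2 - (norm (ip x y))\<^sup>2 / (norm y)\<^sup>2\<close>,
  and a square is nonnegative.\<close>

lemma norm_ip_le: "norm (ip x y) \<le> norm x * norm y"
proof (cases "y = 0")
  case False
  define c where "c = ip x y / of_real ((norm y)\<^sup>2)"
  define w where "w = x - smul c y"
  have orth: "ip w y = 0"
    using False by (simp add: w_def c_def ip_diff_left ip_scale_left ip_self)
  then have orth': "ip y w = 0"
    using ip_commute[of y w] by (simp add: conjugate_zero)
  have "ip w w = ip x w - c * ip y w"
    by (simp add: w_def ip_diff_left ip_scale_left)
  also have "\<dots> = ip x w" using orth' by simp
  finally have "ip w w = conjugate (ip w x)" by (simp add: ip_commute[of x w])
  \<comment> \<open>\<open>ip w w\<close> is its own conjugate\<close>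
  then have "ip w w = ip w x"
    by (metis conjugate_conjugate ip_commute)
  also have "\<dots> = ip x x - (ip x y * ip y x) / of_real ((norm y)\<^sup>2)"
    by (simp add: w_def c_def ip_diff_left ip_scale_left)
  also have "\<dots> = of_real ((norm x)\<^sup>2 - (norm (ip x y))\<^sup>2 / (norm y)\<^sup>2)"
    by (simp only: ip_mult_ip_commute ip_self of_real_diff of_real_divide)
  finally have "(norm w)\<^sup>2 = (norm x)\<^sup>2 - (norm (ip x y))\<^sup>2 / (norm y)\<^sup>2"
    unfolding ip_self of_real_eq_iff .
  then have "(norm (ip x y))\<^sup>2 / (norm y)\<^sup>2 \<le> (norm x)\<^sup>2"
    by (metis diff_ge_0_iff_ge zero_le_power2)
  then have "(norm (ip x y))\<^sup>2 \<le> (norm x * norm y)\<^sup>2"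
    using False by (simp add: divide_le_eq power_mult_distrib)
  then show ?thesis by (rule power2_le_imp_le) simp
qed (simp add: ip_zero_right)

lemma bounded_linear_ip_left: "bounded_linear (\<lambda>x. ip x y)"
proof (rule bounded_linear_intro[where K = "norm y"])
  show "ip (r *\<^sub>R x) y = r *\<^sub>R ip x y" for r x
    by (simp add: ip_scale_left scaleR_conv_of_real flip: scale_of_real)
qed (auto simp: ip_add_left norm_ip_le)

section \<open>Bounds for the partial frame operators\<close>

text \<open>The synthesis map \<open>c \<mapsto> (\<Sum>i\<in>F. c i \<phi>\<^sub>i)\<close> is adjoint to the analysis map, so a bound for the
  latter is one for the former: test the vector \<open>y = (\<Sum>i\<in>F. c i \<phi>\<^sub>i)\<close> against itself and apply the
  Cauchy--Schwarz inequality to the coefficients.\<close>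

lemma norm_synthesis_square_le:
  assumes B: "0 \<le> B"
    and bessel: "\<And>y. (\<Sum>i\<in>F. (norm (ip y (\<phi> i)))\<^sup>2) \<le> B * (norm y)\<^sup>2"
  shows "(norm (\<Sum>i\<in>F. smul (c i) (\<phi> i)))\<^sup>2 \<le> B * (\<Sum>i\<in>F. (norm (c i))\<^sup>2)"
proof -
  define y where "y = (\<Sum>i\<in>F. smul (c i) (\<phi> i))"
  define Q where "Q = (\<Sum>i\<in>F. (norm (c i))\<^sup>2)"
  have Q: "0 \<le> Q" by (simp add: Q_def sum_nonneg)
  interpret left: bounded_linear "\<lambda>x. ip x y" by (rule bounded_linear_ip_left)
  have "ip y y = (\<Sum>i\<in>F. c i * ip (\<phi> i) y)"
    using left.sum[of "\<lambda>i. smul (c i) (\<phi> i)" F] by (simp add: ip_scale_left flip: y_def)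
  then have "(norm y)\<^sup>2 = norm (\<Sum>i\<in>F. c i * ip (\<phi> i) y)"
    by (metis ip_self norm_of_real abs_of_nonneg zero_le_power2)
  also have "\<dots> \<le> (\<Sum>i\<in>F. norm (c i * ip (\<phi> i) y))" by (rule norm_sum)
  also have "\<dots> = (\<Sum>i\<in>F. \<bar>norm (c i)\<bar> * \<bar>norm (ip y (\<phi> i))\<bar>)"
    by (simp add: norm_mult norm_ip_commute[of y])
  also have "\<dots> \<le> L2_set (\<lambda>i. norm (c i)) F * L2_set (\<lambda>i. norm (ip y (\<phi> i))) F"
    by (rule L2_set_mult_ineq)
  also have "\<dots> \<le> sqrt Q * sqrt (B * (norm y)\<^sup>2)"
    unfolding L2_set_def Q_def
    by (intro mult_left_mono real_sqrt_le_mono bessel) (simp add: sum_nonneg)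
  also have "\<dots> = sqrt (B * Q) * norm y" by (simp add: real_sqrt_mult)
  finally have *: "norm y * norm y \<le> sqrt (B * Q) * norm y" by (simp add: power2_eq_square)
  have "norm y \<le> sqrt (B * Q)"
  proof (cases "y = 0")
    case True
    then show ?thesis using B Q by simp
  next
    case False
    then show ?thesis using * by simp
  qed
  then have "(norm y)\<^sup>2 \<le> B * Q"
    using B Q by (metis mult_nonneg_nonneg norm_ge_zero power_mono real_sqrt_pow2)
  then show ?thesis by (simp add: y_def Q_def)
qed

lemma frame_bounds_finite_bessel:
  assumes "frame_bounds ip I \<phi> A B" and "finite F" "F \<subseteq> I"
  shows "(\<Sum>i\<in>F. (norm (ip y (\<phi> i)))\<^sup>2) \<le> B * (norm y)\<^sup>2"
proof -
  have "(\<Sum>i\<in>F. (norm (ip y (\<phi> i)))\<^sup>2) \<le> (\<Sum>\<^sub>\<infinity>i\<in>I. (norm (ip y (\<phi> i)))\<^sup>2)"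
    using assms by (intro finite_sum_le_infsum) (auto simp: frame_bounds_def)
  also have "\<dots> \<le> B * (norm y)\<^sup>2" using assms(1) by (simp add: frame_bounds_def)
  finally show ?thesis .
qed

lemma frame_bounds_summable_on_subset:
  assumes "frame_bounds ip I \<phi> A B" and "\<sigma> \<subseteq> I"
  shows "(\<lambda>i. (norm (ip x (\<phi> i)))\<^sup>2) summable_on \<sigma>"
  using assms by (auto simp: frame_bounds_def intro: summable_on_subset)

lemma norm_finite_frame_sum_square_le:
  assumes fb: "frame_bounds ip I \<phi> A B" and "finite F" "F \<subseteq> I"
  shows "(norm (\<Sum>i\<in>F. smul (ip x (\<phi> i)) (\<phi> i)))\<^sup>2 \<le> B * (\<Sum>i\<in>F. (norm (ip x (\<phi> i)))\<^sup>2)"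
  using assms
  by (intro norm_synthesis_square_le frame_bounds_finite_bessel[OF fb])
    (auto simp: frame_bounds_def)

lemma has_sum_partial_frame_operator:
  assumes fb: "frame_bounds ip I \<phi> A B" and \<sigma>: "\<sigma> \<subseteq> I"
  shows "((\<lambda>i. smul (ip x (\<phi> i)) (\<phi> i)) has_sum partial_frame_operator smul ip \<phi> \<sigma> x) \<sigma>"
  unfolding partial_frame_operator_def
proof (rule has_sum_infsum, rule summable_on_if_norm_sum_square_le)
  show "(\<lambda>i. (norm (ip x (\<phi> i)))\<^sup>2) summable_on \<sigma>"
    by (rule frame_bounds_summable_on_subset[OF fb \<sigma>])
  show "0 \<le> B" using fb by (auto simp: frame_bounds_def)
  show "(norm (\<Sum>i\<in>F. smul (ip x (\<phi> i)) (\<phi> i)))\<^sup>2 \<le> B * (\<Sum>i\<in>F. (norm (ip x (\<phi> i)))\<^sup>2)"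
    if "finite F" "F \<subseteq> \<sigma>" for F
    using that \<sigma> by (intro norm_finite_frame_sum_square_le[OF fb]) auto
qed simp

lemma norm_partial_frame_operator_le:
  assumes fb: "frame_bounds ip I \<phi> A B" and \<sigma>: "\<sigma> \<subseteq> I"
  shows "(norm (partial_frame_operator smul ip \<phi> \<sigma> x))\<^sup>2
    \<le> B * (\<Sum>\<^sub>\<infinity>i\<in>\<sigma>. (norm (ip x (\<phi> i)))\<^sup>2)"
proof (rule norm_has_sum_square_le[OF has_sum_partial_frame_operator[OF fb \<sigma>]])
  show "(\<lambda>i. (norm (ip x (\<phi> i)))\<^sup>2) summable_on \<sigma>"
    by (rule frame_bounds_summable_on_subset[OF fb \<sigma>])
  show "0 \<le> B" using fb by (auto simp: frame_bounds_def)
  show "(norm (\<Sum>i\<in>F. smul (ip x (\<phi> i)) (\<phi> i)))\<^sup>2 \<le> B * (\<Sum>i\<in>F. (norm (ip x (\<phi> i)))\<^sup>2)"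
    if "finite F" "F \<subseteq> \<sigma>" for F
    using that \<sigma> by (intro norm_finite_frame_sum_square_le[OF fb]) auto
qed simp

lemma ip_partial_frame_operator_self:
  assumes fb: "frame_bounds ip I \<phi> A B" and \<sigma>: "\<sigma> \<subseteq> I"
  shows "ip (partial_frame_operator smul ip \<phi> \<sigma> x) x
    = of_real (\<Sum>\<^sub>\<infinity>i\<in>\<sigma>. (norm (ip x (\<phi> i)))\<^sup>2)"
proof -
  have "((\<lambda>i. ip (smul (ip x (\<phi> i)) (\<phi> i)) x) has_sum ip (partial_frame_operator smul ip \<phi> \<sigma> x) x) \<sigma>"
    by (rule has_sum_bounded_linear[OF bounded_linear_ip_left
          has_sum_partial_frame_operator[OF fb \<sigma>]])
  moreover have "((\<lambda>i. of_real ((norm (ip x (\<phi> i)))\<^sup>2) :: 'k)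
      has_sum of_real (\<Sum>\<^sub>\<infinity>i\<in>\<sigma>. (norm (ip x (\<phi> i)))\<^sup>2)) \<sigma>"
    by (intro has_sum_of_real has_sum_infsum frame_bounds_summable_on_subset[OF fb \<sigma>])
  ultimately show ?thesis
    unfolding ip_scale_left ip_mult_ip_commute by (rule has_sum_unique)
qed

text \<open>With \<open>q = ip (S x) x\<close>, the Cauchy--Schwarz inequality and \<open>A * (norm x)\<^sup>2 \<le> q\<close> give
  \<open>A * q\<^sup>2 \<le> (norm (S x))\<^sup>2 * (A * (norm x)\<^sup>2) \<le> (norm (S x))\<^sup>2 * q\<close>; divide by \<open>q\<close>
  if it is positive.\<close>

lemma norm_frame_operator_ge:
  assumes fb: "frame_bounds ip I \<phi> A B"
  shows "A * (\<Sum>\<^sub>\<infinity>i\<in>I. (norm (ip x (\<phi> i)))\<^sup>2)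
    \<le> (norm (partial_frame_operator smul ip \<phi> I x))\<^sup>2"
proof -
  define q where "q = (\<Sum>\<^sub>\<infinity>i\<in>I. (norm (ip x (\<phi> i)))\<^sup>2)"
  define s where "s = norm (partial_frame_operator smul ip \<phi> I x)"
  have A: "0 < A" and lower: "A * (norm x)\<^sup>2 \<le> q"
    using fb by (auto simp: frame_bounds_def q_def)
  have q: "0 \<le> q" unfolding q_def by (rule infsum_nonneg) simp
  have "norm (of_real q :: 'k) \<le> s * norm x"
    unfolding q_def s_def ip_partial_frame_operator_self[OF fb order_refl, symmetric]
    by (rule norm_ip_le)
  then have "q \<le> s * norm x" using q by simp
  then have "q\<^sup>2 \<le> (s * norm x)\<^sup>2" using q by (rule power_mono)
  then have "A * q\<^sup>2 \<le> A * (s * norm x)\<^sup>2"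
    using A by simp
  also have "\<dots> = s\<^sup>2 * (A * (norm x)\<^sup>2)" by (simp add: power_mult_distrib)
  also have "\<dots> \<le> s\<^sup>2 * q" using lower by (simp add: mult_left_mono)
  finally have "(A * q) * q \<le> s\<^sup>2 * q" by (simp add: power2_eq_square)
  then have "A * q \<le> s\<^sup>2"
    using q by (cases "q = 0") (auto simp: mult_le_cancel_right)
  then show ?thesis by (simp add: q_def s_def)
qed

end

section \<open>The equality case\<close>

theorem corollary3p3:
  fixes smul :: "'k::real_or_complex \<Rightarrow> 'a::banach \<Rightarrow> 'a"
    and ip :: "'a \<Rightarrow> 'a \<Rightarrow> 'k"
    and I \<sigma> :: "nat set"
    and \<phi> :: "nat \<Rightarrow> 'a"
    and A B :: real
    and S :: "'a \<Rightarrow> 'a"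
    and x :: 'a
  assumes "hilbert_space smul ip"
    and "separable TYPE('a)"
    and "frame_index_set I"
    and "frame ip I \<phi>"
    and "optimal_frame_bounds ip I \<phi> A B"
    and "S = partial_frame_operator smul ip \<phi> I"
    and "\<sigma> \<subseteq> I"
    and "norm (partial_frame_operator smul ip \<phi> \<sigma> x) = sqrt (B / A) * norm (S x)"
  shows "(x \<noteq> 0 \<longrightarrow> tight_frame ip I \<phi> \<and> A = B) \<and>
    (\<forall>i\<in>I - \<sigma>. ip x (\<phi> i) = 0)"
proof -
  interpret hilbert_space smul ip by fact
  let ?S = "partial_frame_operator smul ip \<phi>"
  let ?q = "\<lambda>\<tau>. \<Sum>\<^sub>\<infinity>i\<in>\<tau>. (norm (ip x (\<phi> i)))\<^sup>2"
  have fb: "frame_bounds ip I \<phi> A B" using assms(5) by (simp add: optimal_frame_bounds_def)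
  have A: "0 < A" and B: "0 < B" and lower: "A * (norm x)\<^sup>2 \<le> ?q I"
    using fb by (auto simp: frame_bounds_def)
  note ge = norm_frame_operator_ge[OF fb, of x]
  have eq: "(norm (?S \<sigma> x))\<^sup>2 = B / A * (norm (?S I x))\<^sup>2"
    using A B by (simp add: assms(6) assms(8) power_mult_distrib)
  have "B * ?q I = B / A * (A * ?q I)" using A by simp
  also have "\<dots> \<le> B / A * (norm (?S I x))\<^sup>2"
    using ge A B by (intro mult_left_mono) auto
  also have "\<dots> \<le> B * ?q \<sigma>"
    unfolding eq[symmetric] by (rule norm_partial_frame_operator_le[OF fb assms(7)])
  finally have "?q I \<le> ?q \<sigma>" using B by simp
  moreover have "?q I = ?q \<sigma> + ?q (I - \<sigma>)"
  proof -
    have "?q (\<sigma> \<union> (I - \<sigma>)) = ?q \<sigma> + ?q (I - \<sigma>)"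
      using assms(7) by (intro infsum_Un_disjoint frame_bounds_summable_on_subset[OF fb]) auto
    moreover have "\<sigma> \<union> (I - \<sigma>) = I" using assms(7) by blast
    ultimately show ?thesis by simp
  qed
  ultimately have "?q (I - \<sigma>) \<le> 0" by simp
  then have "(norm (ip x (\<phi> i)))\<^sup>2 = 0" if "i \<in> I - \<sigma>" for i
    using that by (intro nonneg_infsum_le_0D[of "\<lambda>i. (norm (ip x (\<phi> i)))\<^sup>2" "I - \<sigma>" i]
        frame_bounds_summable_on_subset[OF fb]) auto
  then have orth: "\<forall>i\<in>I - \<sigma>. ip x (\<phi> i) = 0" by simp
  have "A = B" if "x \<noteq> 0"
  proof -
    have "?S \<sigma> x = ?S I x"
      unfolding partial_frame_operator_def
      using orth assms(7) by (intro infsum_cong_neutral) auto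
    moreover have "0 < (norm (?S I x))\<^sup>2"
    proof -
      have "0 < A * (norm x)\<^sup>2" using A that by simp
      then have "0 < A * ?q I" using A lower by simp
      then show ?thesis using ge by linarith
    qed
    ultimately have "B / A = 1" using eq by (metis less_irrefl mult_cancel_right1)
    then show ?thesis using A by (simp add: divide_eq_eq)
  qed
  then show ?thesis
    using orth assms(5) by (auto simp: tight_frame_def)
qed

end
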